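(* Let $H$ be a lower entropy function. Let $n,m\ge1$ be integers, let $(p_1,\dots,p_n)\in\Omega_n$, and for each $i\in\{1,\dots,n\}$ let $(p_{i1},\dots,p_{im})\in\Omega_m$ (the conditional probabilities $p_{ij}=P(Y=y_j\mid X=x_i)$, where $X$ has distribution $(p_1,\dots,p_n)$). Then $$H(p_1p_{11},\dots,p_1p_{1m},\,p_2p_{21},\dots,p_2p_{2m},\,\dots,\,p_np_{n1},\dots,p_np_{nm})\ge H(p_1,\dots,p_n)+\sum_{i=1}^n p_iH(p_{i1},\dots,p_{im}).$$ That is, $H(X+Y)\ge H(X)+H(Y/X)$, where $H(X+Y)$ denotes $H$ of the joint distribution of $(X,Y)$ and $H(Y/X)=\sum_{i=1}^n p_iH(p_{i1},\dots,p_{im})$.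
   Context: For each integer $N\ge 1$ let $\Omega_N=\{(p_1,\dots,p_N): p_i\ge 0,\ \sum_{i=1}^N p_i=1\}$, and let $\Omega=\bigcup_{N\ge1}\Omega_N$. A function $H:\Omega\to\mathbb{R}$ is called a lower entropy function if it satisfies: (i) Continuity: the restriction of $H$ to each $\Omega_N$ is continuous, and $H(p_1,\dots,p_N)=0$ if and only if there is $k$ with $p_k=1$. (ii) Symmetric expansibility: $H(p_1,\dots,p_N)$ is invariant under permutations of its arguments, and $H(p_1,\dots,p_{n-1},p_n,\dots,p_N)=H(p_1,\dots,p_{n-1},0,p_n,\dots,p_N)$ for all $(p_1,\dots,p_N)\in\Omega_N$ and $1\le n\le N$. (iii) Increasing property: if $(p_1,\dots,p_N)\in\Omega_N$, $1\le n\le N$, $m\ge1$, $q_1,\dots,q_m\ge 0$ and $p_n=\sum_{i=1}^m q_i$, then $$H(p_1,\dots,p_{n-1},q_1,\dots,q_m,p_{n+1},\dots,p_N)-H(p_1,\dots,p_N)\ge p_n H\Big(\frac{q_1}{p_n},\dots,\frac{q_m}{p_n}\Big),$$ where the right-hand side is read as $0$ when $p_n=0$. (iv) Maximum: for every $N\ge1$ and $(p_1,\dots,p_N)\in\Omega_N$, $H(p_1,\dots,p_N)\le H(\frac1N,\dots,\frac1N)$. *)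

theory Defs
  imports "HOL-Analysis.Analysis" "HOL-Library.Multiset"
begin

text \<open>Finite probability distributions are lists of reals, so that one function \<open>H\<close> can take
  vectors of every length. The set is empty for \<open>N = 0\<close>, the empty sum not being \<open>1\<close>.\<close>

definition prob_vec :: "nat \<Rightarrow> real list set" where
  "prob_vec N = {p. length p = N \<and> (\<forall>x\<in>set p. 0 \<le> x) \<and> sum_list p = 1}"

text \<open>There is no topology on lists. For continuity, \<open>\<real>\<^sup>N\<close> is therefore taken as the product
  topology on the extensional functions on \<open>{..<N}\<close>, and \<open>map x [0..<N]\<close> is the list of the
  coordinates of \<open>x\<close>.

  Positions in lists count from 0. In \<open>increasing\<close> the right-hand side is \<open>0\<close> when \<open>p ! n = 0\<close>,
  whatever the value of \<open>H\<close> there, as it is multiplied by \<open>p ! n\<close>. Nothing is assumed about \<open>H\<close>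
  on lists that are not probability vectors.\<close>

locale lower_entropy =
  fixes H :: "real list \<Rightarrow> real"
  assumes continuous:
      "\<And>N. continuous_map
             (subtopology (powertop_real {..<N}) {x. map x [0..<N] \<in> prob_vec N})
             euclideanreal
             (\<lambda>x. H (map x [0..<N]))"
    and eq_0_iff:
      "\<And>N p. p \<in> prob_vec N \<Longrightarrow> H p = 0 \<longleftrightarrow> (\<exists>k<N. p ! k = 1)"
    and symmetric:
      "\<And>N p q. p \<in> prob_vec N \<Longrightarrow> mset q = mset p \<Longrightarrow> H q = H p"
    and expansible:
      "\<And>N p n. p \<in> prob_vec N \<Longrightarrow> n < N \<Longrightarrow> H p = H (take n p @ 0 # drop n p)"
    and increasing:
      "\<And>N p n q. p \<in> prob_vec N \<Longrightarrow> n < N \<Longrightarrow> 1 \<le> length q \<Longrightarrow> (\<forall>x\<in>set q. 0 \<le> x) \<Longrightarrow>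
         p ! n = sum_list q \<Longrightarrow>
         H (take n p @ q @ drop (Suc n) p) - H p \<ge> p ! n * H (map (\<lambda>x. x / p ! n) q)"
    and maximum:
      "\<And>N p. p \<in> prob_vec N \<Longrightarrow> H p \<le> H (replicate N (1 / real N))"

text \<open>If \<open>p\<close> is the distribution of \<open>X\<close> and \<open>P i\<close> the distribution of \<open>Y\<close> conditional on the
  \<open>i\<close>-th value of \<open>X\<close>, this is the distribution of \<open>(X, Y)\<close>, row by row.\<close>

definition joint_vec :: "real list \<Rightarrow> (nat \<Rightarrow> real list) \<Rightarrow> real list" where
  "joint_vec p P = concat (map (\<lambda>i. map (\<lambda>x. p ! i * x) (P i)) [0..<length p])"

definition cond_entropy :: "(real list \<Rightarrow> real) \<Rightarrow> real list \<Rightarrow> (nat \<Rightarrow> real list) \<Rightarrow> real" where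
  "cond_entropy H p P = (\<Sum>i<length p. p ! i * H (P i))"

end

theory Submission
  imports Defs
begin

text \<open>The joint distribution arises from \<open>p\<close> by splitting one entry after the other: the entry
  \<open>p ! i\<close> is replaced by the row of the numbers \<open>p ! i * x\<close> with \<open>x\<close> in \<open>P i\<close>. Such a row sums to
  \<open>p ! i\<close> and, unless \<open>p ! i = 0\<close>, normalises to \<open>P i\<close>, so the increasing property says that this splitting raises \<open>H\<close>
  by at least \<open>p ! i * H (P i)\<close>, whatever the other entries are (\<open>entropy_split_entry\<close>). The \<open>n\<close>
  gains add up to the conditional entropy. Every intermediate list must be a probability vector for
  the next splitting to be covered by the increasing property; hence the induction carries this
  fact along (\<open>entropy_split_first_rows\<close>).\<close>

lemma prob_vec_split_entry:
  assumes "xs @ a # ys \<in> prob_vec N" and "v \<in> prob_vec m"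
  shows "xs @ map (\<lambda>x. a * x) v @ ys \<in> prob_vec (length xs + m + length ys)"
  using assms by (auto simp: prob_vec_def sum_list_const_mult)

lemma (in lower_entropy) entropy_split_entry:
  assumes p: "xs @ a # ys \<in> prob_vec N" and v: "v \<in> prob_vec m"
  shows "H (xs @ a # ys) + a * H v \<le> H (xs @ map (\<lambda>x. a * x) v @ ys)"
proof -
  let ?q = "map (\<lambda>x. a * x) v"
  have "0 \<le> a" and len: "length xs < N" and nonneg: "\<forall>x\<in>set ?q. 0 \<le> x"
    using p v by (auto simp: prob_vec_def)
  have sum: "(xs @ a # ys) ! length xs = sum_list ?q"
    using v by (simp add: prob_vec_def sum_list_const_mult)
  have "v \<noteq> []"
    using v by (auto simp: prob_vec_def)
  then have "1 \<le> length ?q"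
    by (cases v) auto
  from increasing[OF p len this nonneg sum]
  have incr: "a * H (map (\<lambda>x. x / a) ?q) \<le> H (xs @ ?q @ ys) - H (xs @ a # ys)"
    by simp
  \<comment> \<open>For \<open>a = 0\<close> the row does not normalise to \<open>v\<close>, but the factor \<open>a\<close> removes the entropy of
    both.\<close>
  have "a * H (map (\<lambda>x. x / a) ?q) = a * H v"
    by (cases "a = 0") (simp_all add: comp_def)
  with incr show ?thesis
    by linarith
qed

lemma (in lower_entropy) entropy_split_first_rows:
  fixes p P
  defines "split \<equiv> \<lambda>k. concat (map (\<lambda>i. map (\<lambda>x. p ! i * x) (P i)) [0..<k]) @ drop k p"
  assumes p: "p \<in> prob_vec n"
    and P: "\<And>i. i < n \<Longrightarrow> P i \<in> prob_vec m"
    and "k \<le> n"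
  shows "(\<exists>N. split k \<in> prob_vec N) \<and> H p + (\<Sum>i<k. p ! i * H (P i)) \<le> H (split k)"
  using \<open>k \<le> n\<close>
proof (induction k)
  case 0
  show ?case
    using p by (auto simp: split_def)
next
  case (Suc k)
  let ?xs = "concat (map (\<lambda>i. map (\<lambda>x. p ! i * x) (P i)) [0..<k])"
  let ?ys = "drop (Suc k) p"
  have "k < length p"
    using p Suc.prems by (simp add: prob_vec_def)
  then have before: "split k = ?xs @ p ! k # ?ys"
    by (simp add: split_def Cons_nth_drop_Suc)
  have after: "split (Suc k) = ?xs @ map (\<lambda>x. p ! k * x) (P k) @ ?ys"
    by (simp add: split_def)
  obtain N where N: "?xs @ p ! k # ?ys \<in> prob_vec N"
    using Suc before by auto
  have Pk: "P k \<in> prob_vec m"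
    using P Suc.prems by simp
  have "\<exists>N. split (Suc k) \<in> prob_vec N"
    using prob_vec_split_entry[OF N Pk] after by metis
  moreover have "H (split k) + p ! k * H (P k) \<le> H (split (Suc k))"
    using entropy_split_entry[OF N Pk] before after by simp
  ultimately show ?case
    using Suc by simp
qed

theorem theorem2:
  fixes H :: "real list \<Rightarrow> real" and n m :: nat
    and p :: "real list" and P :: "nat \<Rightarrow> real list"
  assumes "lower_entropy H"
    and "1 \<le> n" and "1 \<le> m"
    and "p \<in> prob_vec n"
    and "\<And>i. i < n \<Longrightarrow> P i \<in> prob_vec m"
  shows "H (joint_vec p P) \<ge> H p + cond_entropy H p P"
proof -
  interpret lower_entropy H by fact
  have "length p = n"
    using assms(4) by (simp add: prob_vec_def)
  then show ?thesis
    using entropy_split_first_rows[of p n P m n] assms(4,5)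
    by (simp add: joint_vec_def cond_entropy_def)
qed

end
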